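(* Let $x^* \in \mathbb{R}^n$ be a local solution of the optimization problem $$\min_{x\in\mathbb{R}^n} f(x) \quad \text{s.t.} \quad h(x) = 0,\quad g(x) \geq 0,$$ where $f:\mathbb{R}^n\to\mathbb{R}$, $h:\mathbb{R}^n\to\mathbb{R}^{m_h}$ and $g:\mathbb{R}^n\to\mathbb{R}^{m_g}$ are continuously differentiable. Assume that the active constraint gradients at $x^*$, namely $$\{\nabla h_i(x^* ) \mid i=1,\ldots,m_h\} \cup \{\nabla g_i(x^* ) \mid g_i(x^* )=0,\ i=1,\ldots,m_g\},$$ are linearly independent. Then there exist multipliers $\lambda^*\in\mathbb{R}^{m_h}$ and $\mu^*\in\mathbb{R}^{m_g}$ such that $y^* = \begin{bmatrix} x^{*T} & \lambda^{*T} & \mu^{*T}\end{bmatrix}^T$ satisfies $$r(y^* ) = 0,$$ where $r$ is the residual function defined in the context.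
   Context: The inequality $g(x)\ge 0$ is componentwise. Let $N = n+m_h+m_g$, and write $y = \begin{bmatrix} x^T & \lambda^T & \mu^T\end{bmatrix}^T\in\mathbb{R}^N$ with $x\in\mathbb{R}^n$, $\lambda\in\mathbb{R}^{m_h}$, $\mu\in\mathbb{R}^{m_g}$. The Lagrangian is $L(x,\lambda,\mu) = f(x) - h(x)^T\lambda - g(x)^T\mu$, and $\nabla L(x,\lambda,\mu)\in\mathbb{R}^n$ denotes its gradient with respect to $x$. The residual function $r:\mathbb{R}^N\to\mathbb{R}^N$ is $$r(y) = \begin{bmatrix} \nabla L(x,\lambda,\mu) \\ -h(x) \\ \tfrac12\left(|g(x)-\mu| - g(x) - \mu\right)\end{bmatrix},$$ where the absolute value is taken componentwise. Linear independence is understood for the family of gradients indexed by all equality constraints and all active inequality constraints. *)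

theory Defs
  imports "HOL-Analysis.Analysis" "Jordan_Normal_Form.Matrix"
begin

(* The decision space is real ^ 'n. The multiplier and constraint spaces of dimensions mh and mg
   are carrier_vec mh and carrier_vec mg, so that mh = 0 and mg = 0 are covered.
   Below, $ and \<bullet> are component access and dot product of the latter. *)

no_notation Finite_Cartesian_Product.vec_nth (infixl \<open>$\<close> 90)
no_notation inner (infix \<open>\<bullet>\<close> 70)

hide_type (open) Finite_Cartesian_Product.vec
hide_const (open) Finite_Cartesian_Product.vec

(* Meaningful only where f is differentiable; the gradient is then unique. *)
definition gradient :: "(real ^ 'n \<Rightarrow> real) \<Rightarrow> real ^ 'n \<Rightarrow> real ^ 'n" where
  "gradient f x = (THE D. GDERIV f x :> D)"

definition continuously_differentiable :: "(real ^ 'n \<Rightarrow> real) \<Rightarrow> bool" where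
  "continuously_differentiable f \<longleftrightarrow>
     (\<forall>x. f differentiable (at x)) \<and> continuous_on UNIV (gradient f)"

(* The type of variable-length vectors carries no topology, so a map into it is
   C^1 when all its components are. *)
definition continuously_differentiable_map :: "nat \<Rightarrow> (real ^ 'n \<Rightarrow> real vec) \<Rightarrow> bool" where
  "continuously_differentiable_map m F \<longleftrightarrow>
     F \<in> UNIV \<rightarrow> carrier_vec m \<and> (\<forall>i<m. continuously_differentiable (\<lambda>x. F x $ i))"

definition feasible_set ::
  "nat \<Rightarrow> nat \<Rightarrow> (real ^ 'n \<Rightarrow> real vec) \<Rightarrow> (real ^ 'n \<Rightarrow> real vec) \<Rightarrow> (real ^ 'n) set" where
  "feasible_set mh mg h g = {x. h x = 0\<^sub>v mh \<and> (\<forall>i<mg. g x $ i \<ge> 0)}"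

definition local_minimizer :: "(real ^ 'n \<Rightarrow> real) \<Rightarrow> (real ^ 'n) set \<Rightarrow> real ^ 'n \<Rightarrow> bool" where
  "local_minimizer f S xs \<longleftrightarrow>
     xs \<in> S \<and> (\<exists>\<epsilon>>0. \<forall>x\<in>S. dist x xs < \<epsilon> \<longrightarrow> f xs \<le> f x)"

(* Independence of a finite indexed family: unlike independence of the set v ` I,
   it excludes repeated vectors. *)
definition independent_family :: "'i set \<Rightarrow> ('i \<Rightarrow> real ^ 'n) \<Rightarrow> bool" where
  "independent_family I v \<longleftrightarrow>
     (\<forall>c :: 'i \<Rightarrow> real. (\<Sum>i\<in>I. c i *\<^sub>R v i) = 0 \<longrightarrow> (\<forall>i\<in>I. c i = 0))"

definition active_gradients_independent ::
  "nat \<Rightarrow> nat \<Rightarrow> (real ^ 'n \<Rightarrow> real vec) \<Rightarrow> (real ^ 'n \<Rightarrow> real vec) \<Rightarrow> real ^ 'n \<Rightarrow> bool" where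
  "active_gradients_independent mh mg h g x \<longleftrightarrow>
     independent_family ({i. i < mh} <+> {i. i < mg \<and> g x $ i = 0})
       (case_sum (\<lambda>i. gradient (\<lambda>z. h z $ i) x) (\<lambda>i. gradient (\<lambda>z. g z $ i) x))"

definition lagrangian ::
  "(real ^ 'n \<Rightarrow> real) \<Rightarrow> (real ^ 'n \<Rightarrow> real vec) \<Rightarrow> (real ^ 'n \<Rightarrow> real vec) \<Rightarrow>
     real ^ 'n \<Rightarrow> real vec \<Rightarrow> real vec \<Rightarrow> real" where
  "lagrangian f h g x lam mu = f x - h x \<bullet> lam - g x \<bullet> mu"

(* The stacked vector y is represented by the triple of its blocks (x, lam, mu),
   and likewise for the value of the residual. *)
definition residual ::
  "(real ^ 'n \<Rightarrow> real) \<Rightarrow> (real ^ 'n \<Rightarrow> real vec) \<Rightarrow> (real ^ 'n \<Rightarrow> real vec) \<Rightarrow>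
     (real ^ 'n) \<times> real vec \<times> real vec \<Rightarrow> (real ^ 'n) \<times> real vec \<times> real vec" where
  "residual f h g = (\<lambda>(x, lam, mu).
     (gradient (\<lambda>z. lagrangian f h g z lam mu) x,
      - h x,
      (1 / 2) \<cdot>\<^sub>v (map_vec abs (g x - mu) - g x - mu)))"

end

theory Submission
  imports Defs
begin

text \<open>
  The residual vanishes exactly when \<open>(x, \<lambda>, \<mu>)\<close> is a Karush--Kuhn--Tucker point: its last block is
  \<open>- min (g x) \<mu>\<close>, so it is zero if and only if \<open>g x \<ge> 0\<close>, \<open>\<mu> \<ge> 0\<close> and, in every component, one of
  the two is zero.  What has to be proved is therefore the classical theorem on the existence of
  multipliers under linear independence of the active gradients.

  The proof is McShane's penalty argument, which avoids the implicit function theorem.  Inactive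
  inequalities hold in a whole neighbourhood of the solution \<open>x*\<close> and may be dropped.  In a small
  closed ball around \<open>x*\<close>, minimize \<open>f x + |x - x*|\<^sup>2\<close> plus a large multiple of the squared
  constraint violation.  The quadratic term makes \<open>x*\<close> a strict local solution, and a
  compactness argument then shows that a large penalty keeps the minimizer off the boundary sphere.
  So the minimizer is a stationary point, and this says that \<open>\<nabla>f(x) + 2 (x - x*)\<close> is a combination
  of the constraint gradients at \<open>x\<close>, with nonnegative coefficients on the inequalities
  (\<open>penalized_stationary_point\<close>).

  Letting the ball shrink gives points \<open>x\<^sub>k\<close> tending to \<open>x*\<close> with approximate multipliers \<open>w\<^sub>k\<close>.
  Linear independence provides a dual family \<open>u\<close> to the gradients at \<open>x*\<close>
  (\<open>independent_family_dual\<close>), which reads off coefficients by inner products.  It first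
  bounds the \<open>w\<^sub>k\<close> and then makes them converge, without passing to subsequences
  (\<open>convergent_coefficients\<close>); the limit is the vector of multipliers.
\<close>

section \<open>Gradients\<close>

lemma gradient_eqI:
  assumes "GDERIV f x :> D"
  shows "gradient f x = D"
  unfolding gradient_def
proof (rule the_equality[where P = "\<lambda>D. GDERIV f x :> D", OF assms])
  fix D' assume "GDERIV f x :> D'"
  then have "(\<lambda>h. inner h D') = (\<lambda>h. inner h D)"
    using assms unfolding gderiv_def by (rule has_derivative_unique)
  then have "\<forall>h. inner h D' = inner h D"
    by metis
  then show "D' = D"
    by (simp only: vector_eq_ldot)
qed

lemma differentiable_GDERIV_gradient:
  fixes f :: "real ^ 'n \<Rightarrow> real"
  assumes "f differentiable (at x)"
  shows "GDERIV f x :> gradient f x"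
proof -
  obtain f' where f': "(f has_derivative f') (at x)"
    using assms by (auto simp: differentiable_def)
  define D where "D = adjoint f' 1"
  have "f' h = inner h D" for h
    using adjoint_works[OF has_derivative_linear[OF f'], of h 1] by (simp add: D_def)
  then have "f' = (\<lambda>h. inner h D)"
    by auto
  then have "GDERIV f x :> D"
    using f' by (simp add: gderiv_def)
  then show ?thesis
    using gradient_eqI by metis
qed

lemma continuously_differentiable_has_derivative:
  assumes "continuously_differentiable f"
  shows "(f has_derivative (\<lambda>h. inner h (gradient f x))) (at x)"
  using assms differentiable_GDERIV_gradient[of f x]
  by (auto simp: continuously_differentiable_def gderiv_def)

lemma continuously_differentiable_continuous_on:
  assumes "continuously_differentiable f"
  shows "continuous_on S f"
  using continuously_differentiable_has_derivative[OF assms]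
  by (meson has_derivative_continuous continuous_at_imp_continuous_on)

lemma continuously_differentiable_gradient_tendsto:
  assumes "continuously_differentiable f" "X \<longlonglongrightarrow> x"
  shows "(\<lambda>k. gradient f (X k)) \<longlonglongrightarrow> gradient f x"
proof -
  have "isCont (gradient f) x"
    using assms(1) by (auto simp: continuously_differentiable_def continuous_on_eq_continuous_at)
  then show ?thesis
    using assms(2) by (rule isCont_tendsto_compose)
qed

section \<open>Coefficients with respect to an independent family\<close>

text \<open>
  The dual vector is obtained from the component of \<open>v i\<close> orthogonal to the other members; it is
  nonzero because independence keeps \<open>v i\<close> out of their span.
\<close>

lemma independent_family_dual:
  assumes fin: "finite I" and ind: "independent_family I v" and i: "i \<in> I"
  obtains u where "\<And>j. j \<in> I \<Longrightarrow> inner u (v j) = (if j = i then 1 else 0)"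
proof -
  let ?J = "I - {i}"
  let ?C = "range (\<lambda>c. \<Sum>j\<in>?J. c j *\<^sub>R v j)"
  have C: "(\<Sum>j\<in>?J. c j *\<^sub>R v j) \<in> ?C" for c
    by (rule rangeI)
  have span_sub: "span (v ` ?J) \<subseteq> ?C"
  proof (rule span_minimal)
    show "v ` ?J \<subseteq> ?C"
    proof (rule image_subsetI)
      fix j assume "j \<in> ?J"
      then have "v j = (\<Sum>l\<in>?J. (if l = j then 1 else 0) *\<^sub>R v l)"
        using fin by (simp add: if_distrib[of "\<lambda>a. a *\<^sub>R _"] cong: if_cong)
      then show "v j \<in> ?C" using C[of "\<lambda>l. if l = j then 1 else 0"] by simp
    qed
    show "subspace ?C"
    proof (rule subspaceI)
      show "0 \<in> ?C" using C[of "\<lambda>_. 0"] by simp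
    next
      fix x y assume "x \<in> ?C" "y \<in> ?C"
      then obtain c d where "x = (\<Sum>j\<in>?J. c j *\<^sub>R v j)" "y = (\<Sum>j\<in>?J. d j *\<^sub>R v j)" by blast
      then have "x + y = (\<Sum>j\<in>?J. (c j + d j) *\<^sub>R v j)"
        by (simp add: sum.distrib scaleR_add_left)
      then show "x + y \<in> ?C" using C[of "\<lambda>j. c j + d j"] by simp
    next
      fix a x assume "x \<in> ?C"
      then obtain c where "x = (\<Sum>j\<in>?J. c j *\<^sub>R v j)" by blast
      then have "a *\<^sub>R x = (\<Sum>j\<in>?J. (a * c j) *\<^sub>R v j)"
        by (simp add: scaleR_sum_right)
      then show "a *\<^sub>R x \<in> ?C" using C[of "\<lambda>j. a * c j"] by simp
    qed
  qed
  have notin: "v i \<notin> span (v ` ?J)"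
  proof
    assume "v i \<in> span (v ` ?J)"
    then obtain c where c: "v i = (\<Sum>j\<in>?J. c j *\<^sub>R v j)" using span_sub by blast
    have "(\<Sum>j\<in>I. (if j = i then -1 else c j) *\<^sub>R v j)
        = - v i + (\<Sum>j\<in>?J. (if j = i then -1 else c j) *\<^sub>R v j)"
      using fin i by (simp add: sum.remove)
    also have "(\<Sum>j\<in>?J. (if j = i then -1 else c j) *\<^sub>R v j) = (\<Sum>j\<in>?J. c j *\<^sub>R v j)"
      by (rule sum.cong) auto
    finally have "(\<Sum>j\<in>I. (if j = i then -1 else c j) *\<^sub>R v j) = 0"
      using c by simp
    then have "\<forall>j\<in>I. (if j = i then -1 else c j) = 0"
      using ind[unfolded independent_family_def, rule_format,
          of "\<lambda>j. if j = i then -1 else c j"] by blast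
    then show False using i by force
  qed
  obtain y z where y: "y \<in> span (v ` ?J)"
    and z: "\<And>w. w \<in> span (v ` ?J) \<Longrightarrow> inner z w = 0" and yz: "v i = y + z"
    using orthogonal_subspace_decomp_exists[of "v ` ?J" "v i"]
    unfolding Linear_Algebra.orthogonal_def by metis
  have "z \<noteq> 0"
    using notin y yz by auto
  have "inner z (v i) = inner z z"
    using z[OF y] by (simp add: yz inner_add_right)
  moreover have "inner z (v j) = 0" if "j \<in> I" "j \<noteq> i" for j
    using z[of "v j"] that by (auto intro: span_base)
  ultimately have "inner ((1 / inner z z) *\<^sub>R z) (v j) = (if j = i then 1 else 0)"
    if "j \<in> I" for j
    using that \<open>z \<noteq> 0\<close> by auto
  then show thesis by (rule that)
qed

text \<open>
  Coefficients depend continuously on the vector they represent, even when the family itself is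
  perturbed.  The dual family of the limit \<open>v\<close> recovers \<open>w k i\<close> from \<open>\<Sum>j. w k j v j\<close>, which
  differs from \<open>\<Sum>j. w k j V k j\<close> by at most the size of \<open>w k\<close> times a null sequence; this error is
  first absorbed to bound \<open>w k\<close>, and then tends to zero.
\<close>

lemma convergent_coefficients:
  fixes V :: "nat \<Rightarrow> 'i \<Rightarrow> real ^ 'n"
  assumes fin: "finite I" and ind: "independent_family I v"
    and V: "\<And>i. i \<in> I \<Longrightarrow> (\<lambda>k. V k i) \<longlonglongrightarrow> v i"
    and y: "(\<lambda>k. \<Sum>i\<in>I. w k i *\<^sub>R V k i) \<longlonglongrightarrow> y"
  obtains w' where "\<And>i. i \<in> I \<Longrightarrow> (\<lambda>k. w k i) \<longlonglongrightarrow> w' i"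
    and "(\<Sum>i\<in>I. w' i *\<^sub>R v i) = y"
proof -
  have "\<forall>i\<in>I. \<exists>u. \<forall>j\<in>I. inner u (v j) = (if j = i then 1 else 0)"
    using independent_family_dual[OF fin ind] by metis
  then obtain u where u: "\<And>i j. i \<in> I \<Longrightarrow> j \<in> I \<Longrightarrow> inner (u i) (v j) = (if j = i then 1 else 0)"
    by metis
  define Y where "Y k = (\<Sum>i\<in>I. w k i *\<^sub>R V k i)" for k
  define Z where "Z k = (\<Sum>i\<in>I. w k i *\<^sub>R v i)" for k
  define s where "s k = (\<Sum>i\<in>I. \<bar>w k i\<bar>)" for k
  define d where "d k = (\<Sum>i\<in>I. norm (V k i - v i))" for k
  define M where "M = (\<Sum>i\<in>I. norm (u i))"
  have M0: "M \<ge> 0" and s0: "s k \<ge> 0" and d0: "d k \<ge> 0" for k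
    by (simp_all add: M_def s_def d_def sum_nonneg)
  have coeff: "inner (u i) (Z k) = w k i" if "i \<in> I" for i k
  proof -
    have "inner (u i) (Z k) = (\<Sum>j\<in>I. w k j * (if j = i then 1 else 0))"
      unfolding Z_def inner_sum_right by (intro sum.cong) (auto simp: u that)
    also have "\<dots> = w k i"
      using fin that by (simp add: if_distrib cong: if_cong)
    finally show ?thesis .
  qed
  have sZ: "s k \<le> M * norm (Z k)" for k
    unfolding s_def M_def sum_distrib_right
  proof (rule sum_mono)
    fix i assume "i \<in> I"
    then show "\<bar>w k i\<bar> \<le> norm (u i) * norm (Z k)"
      using Cauchy_Schwarz_ineq2[of "u i" "Z k"] coeff by simp
  qed
  have diff: "norm (Y k - Z k) \<le> s k * d k" for k
  proof -
    have "norm (Y k - Z k) = norm (\<Sum>i\<in>I. w k i *\<^sub>R (V k i - v i))"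
      by (simp add: Y_def Z_def sum_subtractf scaleR_diff_right)
    also have "\<dots> \<le> (\<Sum>i\<in>I. \<bar>w k i\<bar> * norm (V k i - v i))"
      by (rule order_trans[OF norm_sum]) simp
    also have "\<dots> \<le> (\<Sum>i\<in>I. \<bar>w k i\<bar> * d k)"
      unfolding d_def
      by (intro sum_mono mult_left_mono member_le_sum fin) auto
    finally show ?thesis by (simp add: s_def sum_distrib_right)
  qed
  have Ylim: "Y \<longlonglongrightarrow> y"
    using y by (simp add: Y_def[abs_def])
  have "(\<lambda>k. \<Sum>i\<in>I. norm (V k i - v i)) \<longlonglongrightarrow> (\<Sum>i\<in>I. norm (v i - v i))"
    by (intro tendsto_intros V)
  then have dlim: "d \<longlonglongrightarrow> 0"
    by (simp add: d_def[abs_def])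
  then have "(\<lambda>k. M * d k) \<longlonglongrightarrow> M * 0"
    by (intro tendsto_intros)
  then have "\<forall>\<^sub>F k in sequentially. M * d k < 1 / 2"
    by (rule order_tendstoD) simp
  then have s_le: "\<forall>\<^sub>F k in sequentially. s k \<le> 2 * M * norm (Y k)"
  proof eventually_elim
    case (elim k)
    have "norm (Z k) \<le> norm (Y k) + norm (Y k - Z k)"
      using norm_triangle_ineq4[of "Y k" "Y k - Z k"] by simp
    then have "norm (Z k) \<le> norm (Y k) + s k * d k"
      using diff[of k] by linarith
    then have "M * norm (Z k) \<le> M * (norm (Y k) + s k * d k)"
      using M0 by (rule mult_left_mono)
    then have "s k \<le> M * norm (Y k) + s k * (M * d k)"
      using sZ[of k] by (simp add: algebra_simps)
    moreover have "s k * (M * d k) \<le> s k * (1 / 2)"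
      using s0 elim by (intro mult_left_mono) auto
    ultimately show ?case by simp
  qed
  have "(\<lambda>k. Y k - Z k) \<longlonglongrightarrow> 0"
  proof (rule Lim_null_comparison)
    show "\<forall>\<^sub>F k in sequentially. norm (Y k - Z k) \<le> 2 * M * norm (Y k) * d k"
      using s_le
    proof eventually_elim
      case (elim k)
      show ?case
        using diff[of k] mult_right_mono[OF elim d0[of k]] by linarith
    qed
    have "(\<lambda>k. 2 * M * norm (Y k) * d k) \<longlonglongrightarrow> 2 * M * norm y * 0"
      by (intro tendsto_intros Ylim dlim)
    then show "(\<lambda>k. 2 * M * norm (Y k) * d k) \<longlonglongrightarrow> 0" by simp
  qed
  from tendsto_diff[OF Ylim this] have Zlim: "Z \<longlonglongrightarrow> y" by simp
  have wlim: "(\<lambda>k. w k i) \<longlonglongrightarrow> inner (u i) y" if "i \<in> I" for i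
  proof -
    have "(\<lambda>k. inner (u i) (Z k)) \<longlonglongrightarrow> inner (u i) y"
      by (intro tendsto_intros Zlim)
    then show ?thesis by (simp add: coeff that)
  qed
  have "(\<lambda>k. \<Sum>i\<in>I. w k i *\<^sub>R v i) \<longlonglongrightarrow> (\<Sum>i\<in>I. inner (u i) y *\<^sub>R v i)"
    by (intro tendsto_intros wlim)
  then have "Z \<longlonglongrightarrow> (\<Sum>i\<in>I. inner (u i) y *\<^sub>R v i)"
    by (simp add: Z_def[abs_def])
  then have "(\<Sum>i\<in>I. inner (u i) y *\<^sub>R v i) = y"
    using Zlim by (rule LIMSEQ_unique)
  with wlim show thesis by (rule that)
qed

section \<open>Stationary points of the penalized problem\<close>

text \<open>
  On a compact set a sufficiently large penalty enforces a strict bound that holds where the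
  penalty vanishes: on the compact part where the bound fails, the penalty is bounded away from
  zero.
\<close>

lemma exact_penalty_on_compact:
  fixes \<phi> P :: "'a::metric_space \<Rightarrow> real"
  assumes S: "compact S" and \<phi>: "continuous_on S \<phi>" and P: "continuous_on S P"
    and P0: "\<And>x. x \<in> S \<Longrightarrow> P x \<ge> 0"
    and strict: "\<And>x. x \<in> S \<Longrightarrow> P x = 0 \<Longrightarrow> b < \<phi> x"
  shows "\<exists>N\<ge>0. \<forall>x\<in>S. b < \<phi> x + N * P x"
proof -
  let ?K = "{x \<in> S. \<phi> x \<le> b}"
  have "closed ?K"
    by (rule continuous_on_closed_Collect_le[OF \<phi> continuous_on_const compact_imp_closed[OF S]])
  from compact_Int_closed[OF S this] have K: "compact ?K"
    by (simp add: Collect_conj_eq Int_assoc[symmetric])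
  show ?thesis
  proof (cases "?K = {}")
    case True
    then show ?thesis by (intro exI[of _ 0]) force
  next
    case False
    have KS: "?K \<subseteq> S" by auto
    obtain p where p: "p \<in> ?K" "\<And>x. x \<in> ?K \<Longrightarrow> P p \<le> P x"
      using continuous_attains_inf[OF K False continuous_on_subset[OF P KS]] by blast
    obtain q where q: "q \<in> ?K" "\<And>x. x \<in> ?K \<Longrightarrow> \<phi> q \<le> \<phi> x"
      using continuous_attains_inf[OF K False continuous_on_subset[OF \<phi> KS]] by blast
    have Pp: "P p > 0"
      using p(1) P0[of p] strict[of p] by force
    \<comment> \<open>On the critical part, \<open>\<phi>\<close> is at least \<open>\<phi> q\<close> and the penalty at least \<open>P p\<close>; this \<open>N\<close> makes
      their combined value at least \<open>b + 1\<close>.\<close>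
    define N where "N = (b - \<phi> q + 1) / P p"
    have N0: "N \<ge> 0"
      using q(1) Pp by (simp add: N_def)
    show ?thesis
    proof (intro exI[of _ N] conjI N0 ballI)
      fix x assume x: "x \<in> S"
      show "b < \<phi> x + N * P x"
      proof (cases "\<phi> x \<le> b")
        case True
        with x have "N * P p \<le> N * P x" "\<phi> q \<le> \<phi> x"
          using p(2) q(2) N0 by (auto intro: mult_left_mono)
        moreover have "N * P p = b - \<phi> q + 1"
          using Pp by (simp add: N_def)
        ultimately show ?thesis by linarith
      next
        case False
        then show ?thesis
          using N0 P0[OF x] by (smt (verit) mult_nonneg_nonneg)
      qed
    qed
  qed
qed

text \<open>
  The violation of an inequality \<open>c i x \<ge> 0\<close> is \<open>min (c i x) 0\<close>.  Its square need not be
  differentiated: it is the minimum over \<open>s \<ge> 0\<close> of \<open>(c i x - s)\<^sup>2\<close>, so freezing the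
  slacks \<open>s\<close> that are optimal at the minimizer \<open>p\<close> gives a differentiable majorant of the
  penalized objective that touches it at \<open>p\<close> and is hence also minimal there.
\<close>

lemma penalized_stationary_point:
  fixes c :: "'i \<Rightarrow> real ^ 'n \<Rightarrow> real"
  assumes f: "continuously_differentiable f"
    and c: "\<And>i. i \<in> I \<Longrightarrow> continuously_differentiable (c i)"
    and fin: "finite I"
    and min: "local_minimizer f {x. \<forall>i\<in>I. if i \<in> A then c i x \<ge> 0 else c i x = 0} xs"
    and \<delta>: "\<delta> > 0"
  shows "\<exists>p w. dist p xs < \<delta> \<and> (\<forall>i\<in>I \<inter> A. w i \<ge> 0) \<and>
    gradient f p + 2 *\<^sub>R (p - xs) = (\<Sum>i\<in>I. w i *\<^sub>R gradient (c i) p)"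
proof -
  let ?F = "{x. \<forall>i\<in>I. if i \<in> A then c i x \<ge> 0 else c i x = 0}"
  obtain \<epsilon>' where \<epsilon>': "\<epsilon>' > 0" "\<And>x. x \<in> ?F \<Longrightarrow> dist x xs < \<epsilon>' \<Longrightarrow> f xs \<le> f x"
    and xs: "xs \<in> ?F"
    using min unfolding local_minimizer_def by blast
  define \<epsilon> where "\<epsilon> = min \<delta> \<epsilon>' / 2"
  have \<epsilon>: "\<epsilon> > 0" "\<epsilon> < \<delta>" "\<epsilon> < \<epsilon>'"
    using \<delta> \<epsilon>'(1) by (auto simp: \<epsilon>_def min_def)
  define viol where "viol i x = (if i \<in> A then min (c i x) 0 else c i x)" for i x
  define P where "P x = (\<Sum>i\<in>I. (viol i x)\<^sup>2)" for x
  define \<phi> where "\<phi> x = f x + inner (x - xs) (x - xs)" for x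
  have contc: "continuous_on S (c i)" if "i \<in> I" for S i
    using c[OF that] by (rule continuously_differentiable_continuous_on)
  have contv: "continuous_on S (viol i)" if "i \<in> I" for S i
    using contc[OF that] continuous_on_min[OF contc[OF that] continuous_on_const]
    by (cases "i \<in> A") (simp_all add: viol_def[abs_def])
  have contP: "continuous_on S P" for S
    unfolding P_def[abs_def] by (intro continuous_intros contv)
  have cont\<phi>: "continuous_on S \<phi>" for S
    unfolding \<phi>_def[abs_def]
    by (intro continuous_intros continuously_differentiable_continuous_on f)
  have P0: "P x \<ge> 0" for x
    by (simp add: P_def sum_nonneg)
  have viol0: "viol i x = 0 \<longleftrightarrow> (if i \<in> A then c i x \<ge> 0 else c i x = 0)" for i x
    by (simp add: viol_def min_def)
  have PF: "P x = 0 \<longleftrightarrow> x \<in> ?F" for x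
    using fin by (simp add: P_def sum_nonneg_eq_0_iff viol0)
  have sphere: "f xs < \<phi> x" if "x \<in> sphere xs \<epsilon>" "P x = 0" for x
  proof -
    have dx: "norm (x - xs) = \<epsilon>"
      using that(1) by (simp add: dist_norm norm_minus_commute)
    have "f xs \<le> f x"
      using \<epsilon>'(2)[of x] that PF \<epsilon>(3) by (auto simp: dist_commute)
    moreover have "0 < inner (x - xs) (x - xs)"
      using dx \<epsilon>(1) by auto
    ultimately show ?thesis unfolding \<phi>_def by linarith
  qed
  obtain N where N: "N \<ge> 0" "\<And>x. x \<in> sphere xs \<epsilon> \<Longrightarrow> f xs < \<phi> x + N * P x"
    using exact_penalty_on_compact[OF compact_sphere cont\<phi> contP P0 sphere] by blast
  have "cball xs \<epsilon> \<noteq> {}" using \<epsilon>(1) by simp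
  moreover have "continuous_on (cball xs \<epsilon>) (\<lambda>x. \<phi> x + N * P x)"
    by (intro continuous_on_add continuous_on_mult_left cont\<phi> contP)
  ultimately obtain p where p: "p \<in> cball xs \<epsilon>"
    "\<And>x. x \<in> cball xs \<epsilon> \<Longrightarrow> \<phi> p + N * P p \<le> \<phi> x + N * P x"
    using continuous_attains_inf[OF compact_cball, of xs \<epsilon> "\<lambda>x. \<phi> x + N * P x"] by blast
  \<comment> \<open>The centre already attains the value \<open>f xs\<close>, which is exceeded on the whole sphere.\<close>
  have "\<phi> p + N * P p \<le> f xs"
    using p(2)[of xs] \<epsilon>(1) PF[THEN iffD2, OF xs] by (simp add: \<phi>_def)
  then have "p \<notin> sphere xs \<epsilon>"
    using N(2)[of p] by fastforce
  then have pb: "p \<in> ball xs \<epsilon>"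
    using p(1) by (auto simp: less_le)
  define s where "s i = (if i \<in> A then max (c i p) 0 else 0)" for i
  define \<Psi> where "\<Psi> x = \<phi> x + N * (\<Sum>i\<in>I. (c i x - s i)\<^sup>2)" for x
  have viol_p: "viol i p = c i p - s i" for i
    by (auto simp: viol_def s_def)
  have viol_le: "(viol i x)\<^sup>2 \<le> (c i x - s i)\<^sup>2" for i x
  proof (cases "i \<in> A \<and> c i x < 0")
    case True
    then have "\<bar>viol i x\<bar> \<le> \<bar>c i x - s i\<bar>" by (auto simp: viol_def s_def)
    then show ?thesis by (simp only: abs_le_square_iff)
  next
    case False
    then show ?thesis by (auto simp: viol_def s_def)
  qed
  have \<Psi>_min: "\<forall>x\<in>ball xs \<epsilon>. \<Psi> p \<le> \<Psi> x"
  proof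
    fix x assume x: "x \<in> ball xs \<epsilon>"
    have "\<Psi> p = \<phi> p + N * P p"
      by (simp add: \<Psi>_def P_def viol_p)
    also have "\<dots> \<le> \<phi> x + N * P x"
      using p(2)[of x] x by auto
    also have "\<dots> \<le> \<Psi> x"
      unfolding \<Psi>_def P_def using N(1) by (intro add_left_mono mult_left_mono sum_mono viol_le)
    finally show "\<Psi> p \<le> \<Psi> x" .
  qed
  \<comment> \<open>The multipliers are the negated derivatives of the penalty terms at the minimizer; they
    inherit their sign on \<open>A\<close> from the violation, which is never positive there.\<close>
  define w where "w i = - (2 * N * viol i p)" for i
  let ?G = "gradient f p + 2 *\<^sub>R (p - xs) - (\<Sum>i\<in>I. w i *\<^sub>R gradient (c i) p)"
  have "(\<Psi> has_derivative (\<lambda>h. inner h ?G)) (at p)"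
    unfolding \<Psi>_def[abs_def] \<phi>_def[abs_def]
    apply (rule derivative_eq_intros refl continuously_differentiable_has_derivative f c | assumption)+
    apply (rule ext)
    apply (simp add: inner_add_right inner_diff_right inner_sum_right w_def viol_p
        sum_distrib_left sum_negf sum.distrib sum_subtractf algebra_simps inner_commute)
    done
  then have "(\<lambda>h. inner h ?G) = (\<lambda>h. 0)"
    using differential_zero_maxmin[OF pb open_ball] \<Psi>_min by blast
  then have "inner ?G ?G = 0" by metis
  then have "gradient f p + 2 *\<^sub>R (p - xs) = (\<Sum>i\<in>I. w i *\<^sub>R gradient (c i) p)"
    by simp
  moreover have "w i \<ge> 0" if "i \<in> I \<inter> A" for i
    using that N(1) by (auto simp: w_def viol_def mult_nonneg_nonpos)
  moreover have "dist p xs < \<delta>"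
    using pb \<epsilon>(2) by (simp add: dist_commute)
  ultimately show ?thesis by blast
qed

section \<open>Existence of multipliers\<close>

text \<open>
  The conclusion says nothing about complementarity.  It is meant for a family \<open>I\<close> of
  constraints active at \<open>xs\<close>, where complementarity is automatic once every other multiplier is
  set to zero.
\<close>

theorem active_multipliers_exist:
  fixes c :: "'i \<Rightarrow> real ^ 'n \<Rightarrow> real"
  assumes f: "continuously_differentiable f"
    and c: "\<And>i. i \<in> I \<Longrightarrow> continuously_differentiable (c i)"
    and fin: "finite I"
    and min: "local_minimizer f {x. \<forall>i\<in>I. if i \<in> A then c i x \<ge> 0 else c i x = 0} xs"
    and ind: "independent_family I (\<lambda>i. gradient (c i) xs)"
  obtains w where "\<And>i. i \<in> I \<inter> A \<Longrightarrow> w i \<ge> 0"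
    "gradient f xs = (\<Sum>i\<in>I. w i *\<^sub>R gradient (c i) xs)"
proof -
  have "\<forall>k. \<exists>p w. dist p xs < 1 / real (Suc k) \<and> (\<forall>i\<in>I \<inter> A. w i \<ge> 0) \<and>
      gradient f p + 2 *\<^sub>R (p - xs) = (\<Sum>i\<in>I. w i *\<^sub>R gradient (c i) p)"
    by (rule allI, rule penalized_stationary_point[OF f c fin min]) simp_all
  then obtain p w where pw: "\<forall>k. dist (p k) xs < 1 / real (Suc k) \<and> (\<forall>i\<in>I \<inter> A. w k i \<ge> 0) \<and>
      gradient f (p k) + 2 *\<^sub>R (p k - xs) = (\<Sum>i\<in>I. w k i *\<^sub>R gradient (c i) (p k))"
    unfolding choice_iff by blast
  have p: "dist (p k) xs < 1 / real (Suc k)" for k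
    using pw by blast
  have w0: "w k i \<ge> 0" if "i \<in> I \<inter> A" for k i
    using pw that by blast
  have stat: "gradient f (p k) + 2 *\<^sub>R (p k - xs) = (\<Sum>i\<in>I. w k i *\<^sub>R gradient (c i) (p k))" for k
    using pw by blast
  have "(\<lambda>k. dist (p k) xs) \<longlonglongrightarrow> 0"
  proof (rule tendsto_sandwich[OF always_eventually always_eventually tendsto_const
        LIMSEQ_inverse_real_of_nat])
    show "\<forall>k. 0 \<le> dist (p k) xs" by simp
    show "\<forall>k. dist (p k) xs \<le> inverse (real (Suc k))"
      unfolding inverse_eq_divide using less_imp_le[OF p] by (rule allI)
  qed
  then have plim: "p \<longlonglongrightarrow> xs"
    by (simp only: tendsto_dist_iff[of p])
  have "(\<lambda>k. gradient f (p k) + 2 *\<^sub>R (p k - xs)) \<longlonglongrightarrow> gradient f xs + 2 *\<^sub>R (xs - xs)"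
    by (intro tendsto_intros plim continuously_differentiable_gradient_tendsto f)
  then have "(\<lambda>k. \<Sum>i\<in>I. w k i *\<^sub>R gradient (c i) (p k)) \<longlonglongrightarrow> gradient f xs"
    by (simp add: stat)
  moreover have "(\<lambda>k. gradient (c i) (p k)) \<longlonglongrightarrow> gradient (c i) xs" if "i \<in> I" for i
    using c[OF that] plim by (rule continuously_differentiable_gradient_tendsto)
  ultimately obtain w' where w': "\<And>i. i \<in> I \<Longrightarrow> (\<lambda>k. w k i) \<longlonglongrightarrow> w' i"
    and eq: "(\<Sum>i\<in>I. w' i *\<^sub>R gradient (c i) xs) = gradient f xs"
    using convergent_coefficients[OF fin ind, of "\<lambda>k i. gradient (c i) (p k)" w] by blast
  have "w' i \<ge> 0" if "i \<in> I \<inter> A" for i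
    using that w0 by (intro LIMSEQ_le_const[OF w'[of i]]) auto
  then show thesis
    using eq[symmetric] by (rule that)
qed

text \<open>
  An inactive inequality is strict at \<open>xs\<close>, so by continuity it holds nearby and does not affect
  local minimality.
\<close>

lemma local_minimizer_active_constraints:
  fixes g :: "real ^ 'n \<Rightarrow> real vec"
  assumes g: "\<And>i. i < mg \<Longrightarrow> continuous_on UNIV (\<lambda>x. g x $ i)"
    and min: "local_minimizer f (feasible_set mh mg h g) xs"
  shows "local_minimizer f {x. h x = 0\<^sub>v mh \<and> (\<forall>i<mg. g xs $ i = 0 \<longrightarrow> g x $ i \<ge> 0)} xs"
proof -
  obtain \<epsilon> where \<epsilon>: "\<epsilon> > 0"
    "\<And>x. x \<in> feasible_set mh mg h g \<Longrightarrow> dist x xs < \<epsilon> \<Longrightarrow> f xs \<le> f x"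
    and xs: "xs \<in> feasible_set mh mg h g"
    using min unfolding local_minimizer_def by blast
  have "\<forall>\<^sub>F x in nhds xs. \<forall>i\<in>{i. i < mg \<and> g xs $ i > 0}. g x $ i > 0"
  proof (intro eventually_ball_finite ballI)
    fix i assume i: "i \<in> {i. i < mg \<and> g xs $ i > 0}"
    then have "isCont (\<lambda>x. g x $ i) xs"
      using g by (simp add: continuous_on_eq_continuous_at)
    then have "((\<lambda>x. g x $ i) \<longlongrightarrow> g xs $ i) (nhds xs)"
      using tendsto_at_iff_tendsto_nhds[of "\<lambda>x. g x $ i" xs] by (simp add: isCont_def)
    then show "\<forall>\<^sub>F x in nhds xs. g x $ i > 0"
      using i by (auto elim: order_tendstoD)
  qed simp
  then obtain \<delta> where \<delta>: "\<delta> > 0"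
    "\<And>x i. dist x xs < \<delta> \<Longrightarrow> i < mg \<Longrightarrow> g xs $ i > 0 \<Longrightarrow> g x $ i > 0"
    unfolding eventually_nhds_metric by auto
  have "f xs \<le> f x" if "h x = 0\<^sub>v mh" "\<forall>i<mg. g xs $ i = 0 \<longrightarrow> g x $ i \<ge> 0"
    "dist x xs < min \<epsilon> \<delta>" for x
  proof (rule \<epsilon>(2))
    have "g x $ i \<ge> 0" if i: "i < mg" for i
    proof (cases "g xs $ i = 0")
      case True
      then show ?thesis using \<open>\<forall>i<mg. g xs $ i = 0 \<longrightarrow> g x $ i \<ge> 0\<close> i by blast
    next
      case False
      then have "g xs $ i > 0"
        using xs i by (force simp: feasible_set_def)
      then show ?thesis
        using \<delta>(2)[of x i] i \<open>dist x xs < min \<epsilon> \<delta>\<close> by simp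
    qed
    then show "x \<in> feasible_set mh mg h g"
      using that(1) by (simp add: feasible_set_def)
  qed (use that(3) in simp)
  then show ?thesis
    unfolding local_minimizer_def using xs \<epsilon>(1) \<delta>(1)
    by (auto simp: feasible_set_def intro!: exI[of _ "min \<epsilon> \<delta>"])
qed

lemma gradient_lagrangian:
  fixes f :: "real ^ 'n \<Rightarrow> real"
  assumes f: "continuously_differentiable f"
    and h: "\<And>i. i < mh \<Longrightarrow> continuously_differentiable (\<lambda>x. h x $ i)"
    and g: "\<And>i. i < mg \<Longrightarrow> continuously_differentiable (\<lambda>x. g x $ i)"
    and lam: "lam \<in> carrier_vec mh" and mu: "mu \<in> carrier_vec mg"
  shows "gradient (\<lambda>z. lagrangian f h g z lam mu) x =
    gradient f x - (\<Sum>i<mh. lam $ i *\<^sub>R gradient (\<lambda>z. h z $ i) x)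
      - (\<Sum>i<mg. mu $ i *\<^sub>R gradient (\<lambda>z. g z $ i) x)" (is "_ = ?G")
proof (rule gradient_eqI)
  have L: "lagrangian f h g z lam mu = f z - (\<Sum>i<mh. lam $ i * h z $ i) - (\<Sum>i<mg. mu $ i * g z $ i)"
    for z
    using lam mu by (simp add: lagrangian_def scalar_prod_def atLeast0LessThan mult.commute)
  show "GDERIV (\<lambda>z. lagrangian f h g z lam mu) x :> ?G"
    unfolding gderiv_def L inner_diff_right inner_sum_right inner_scaleR_right
    by (intro has_derivative_diff has_derivative_sum has_derivative_mult_right
        continuously_differentiable_has_derivative f h g) auto
qed

theorem corollary1:
  fixes f :: "real ^ 'n \<Rightarrow> real"
    and h g :: "real ^ 'n \<Rightarrow> real vec"
    and mh mg :: nat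
    and xs :: "real ^ 'n"
  assumes "continuously_differentiable f"
    and "continuously_differentiable_map mh h"
    and "continuously_differentiable_map mg g"
    and "local_minimizer f (feasible_set mh mg h g) xs"
    and "active_gradients_independent mh mg h g xs"
  shows "\<exists>lam mu. lam \<in> carrier_vec mh \<and> mu \<in> carrier_vec mg \<and>
           residual f h g (xs, lam, mu) = (0, 0\<^sub>v mh, 0\<^sub>v mg)"
proof -
  have hC: "\<And>x. h x \<in> carrier_vec mh" and h: "\<And>i. i < mh \<Longrightarrow> continuously_differentiable (\<lambda>x. h x $ i)"
    using assms(2) by (auto simp: continuously_differentiable_map_def)
  have gC: "\<And>x. g x \<in> carrier_vec mg" and g: "\<And>i. i < mg \<Longrightarrow> continuously_differentiable (\<lambda>x. g x $ i)"
    using assms(3) by (auto simp: continuously_differentiable_map_def)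
  have hxs: "h xs = 0\<^sub>v mh" and gxs: "\<And>i. i < mg \<Longrightarrow> g xs $ i \<ge> 0"
    using assms(4) by (auto simp: local_minimizer_def feasible_set_def)
  let ?J = "{i. i < mg \<and> g xs $ i = 0}"
  let ?I = "{i. i < mh} <+> ?J"
  define c :: "nat + nat \<Rightarrow> real ^ 'n \<Rightarrow> real"
    where "c = case_sum (\<lambda>i z. h z $ i) (\<lambda>i z. g z $ i)"
  have c: "continuously_differentiable (c i)" if "i \<in> ?I" for i
    using that h g by (auto simp: c_def)
  have "h x = 0\<^sub>v mh \<longleftrightarrow> (\<forall>i<mh. h x $ i = 0)" for x
    using hC[of x] by auto
  then have "{x. \<forall>i\<in>?I. if i \<in> range Inr then c i x \<ge> 0 else c i x = 0}
      = {x. h x = 0\<^sub>v mh \<and> (\<forall>i<mg. g xs $ i = 0 \<longrightarrow> g x $ i \<ge> 0)}"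
    by (auto simp: c_def Plus_def ball_Un)
  then have min: "local_minimizer f {x. \<forall>i\<in>?I. if i \<in> range Inr then c i x \<ge> 0 else c i x = 0} xs"
    using local_minimizer_active_constraints[OF continuously_differentiable_continuous_on[OF g] assms(4)]
    by simp
  have "case_sum (\<lambda>i. gradient (\<lambda>z. h z $ i) xs) (\<lambda>i. gradient (\<lambda>z. g z $ i) xs)
      = (\<lambda>i. gradient (c i) xs)"
    by (auto simp: c_def fun_eq_iff split: sum.split)
  then have ind: "independent_family ?I (\<lambda>i. gradient (c i) xs)"
    using assms(5) by (simp add: active_gradients_independent_def)
  obtain w where w0: "\<And>i. i \<in> ?I \<inter> range Inr \<Longrightarrow> w i \<ge> 0"
    and w: "gradient f xs = (\<Sum>i\<in>?I. w i *\<^sub>R gradient (c i) xs)"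
    using active_multipliers_exist[OF assms(1) c _ min ind] by auto
  define lam where "lam = Matrix.vec mh (\<lambda>i. w (Inl i))"
  define mu where "mu = Matrix.vec mg (\<lambda>i. if g xs $ i = 0 then w (Inr i) else 0)"
  have lamC: "lam \<in> carrier_vec mh" and muC: "mu \<in> carrier_vec mg"
    by (simp_all add: lam_def mu_def)
  have "(\<Sum>i\<in>?J. w (Inr i) *\<^sub>R gradient (\<lambda>z. g z $ i) xs)
      = (\<Sum>i<mg. mu $ i *\<^sub>R gradient (\<lambda>z. g z $ i) xs)"
    by (rule sum.mono_neutral_cong_left) (auto simp: mu_def)
  moreover have "(\<Sum>i<mh. w (Inl i) *\<^sub>R gradient (\<lambda>z. h z $ i) xs)
      = (\<Sum>i<mh. lam $ i *\<^sub>R gradient (\<lambda>z. h z $ i) xs)"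
    by (simp add: lam_def)
  ultimately have "gradient f xs = (\<Sum>i<mh. lam $ i *\<^sub>R gradient (\<lambda>z. h z $ i) xs)
      + (\<Sum>i<mg. mu $ i *\<^sub>R gradient (\<lambda>z. g z $ i) xs)"
    unfolding w by (simp add: sum.Plus c_def lessThan_def)
  then have "gradient (\<lambda>z. lagrangian f h g z lam mu) xs = 0"
    using gradient_lagrangian[OF assms(1) h g lamC muC, of xs] by simp
  moreover have "- h xs = 0\<^sub>v mh"
    by (auto simp: hxs)
  moreover have "(1 / 2) \<cdot>\<^sub>v (map_vec abs (g xs - mu) - g xs - mu) = 0\<^sub>v mg"
  proof (rule eq_vecI)
    fix i assume "i < dim_vec (0\<^sub>v mg :: real vec)"
    then have i: "i < mg" by simp
    have "mu $ i \<ge> 0" "g xs $ i = 0 \<or> mu $ i = 0"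
      using i w0[of "Inr i"] by (auto simp: mu_def)
    then show "((1 / 2) \<cdot>\<^sub>v (map_vec abs (g xs - mu) - g xs - mu)) $ i = 0\<^sub>v mg $ i"
      using i gxs[OF i] gC[of xs] muC by auto
  qed (use gC[of xs] muC in auto)
  ultimately show ?thesis
    using lamC muC by (auto simp: residual_def)
qed

end
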